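(* Let $\Lambda \subset \mathbb{R}^d$ be a repetitive Delone set having finite local complexity (FLC) and such that the density of $\Lambda$ exists. Let $\mathbb{X}_\Lambda$ be the hull of $\Lambda$. Then either $\mathbb{X}_\Lambda$ consists of a single bounded distance equivalence class, or $\mathbb{X}_\Lambda$ contains uncountably many bounded distance equivalence classes.
   Context: A Delone set in $\mathbb{R}^d$ is a set $\Lambda\subset\mathbb{R}^d$ for which there are $r>0$ and $R>0$ such that every open ball of radius $r$ contains at most one point of $\Lambda$ and every closed ball of radius $R$ contains at least one point of $\Lambda$. Two Delone sets $\Lambda,\Lambda'$ in $\mathbb{R}^d$ are bounded distance equivalent (bde) if there is a bijection $\phi:\Lambda\to\Lambda'$ such that $\|x-\phi(x)\|$ is uniformly bounded over $x\in\Lambda$. This is an equivalence relation on Delone sets; the bounded distance equivalence classes in $\mathbb{X}_\Lambda$ are the classes of this relation restricted to $\mathbb{X}_\Lambda$. FLC: $\Lambda$ has finite local complexity if for any compact $K\subset\mathbb{R}^d$ there are, up to translation, only finitely many different patches $(\Lambda-x)\cap K$, $x\in\mathbb{R}^d$. Repetitive: $\Lambda$ is repetitive if for each compact $K\subset\mathbb{R}^d$ with $K\cap\Lambda\neq\varnothing$ the set $\{x\in\mathbb{R}^d \mid (\Lambda-x)\cap K=\Lambda\cap K\}$ is a Delone set. Hull: define the distance of two Delone sets $\Lambda,\Lambda'$ as the infimum of all $\varepsilon\in(0,1)$ for which there exist $x,x'\in\mathbb{R}^d$ with $\|x\|,\|x'\|\le\varepsilon/2$ such that $\Lambda-x$ and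 $\Lambda'-x'$ agree exactly on the ball of radius $1/\varepsilon$ about the origin, and as $1$ if no such $\varepsilon$ exists. The hull $\mathbb{X}_\Lambda$ is the closure, in the resulting topology on Delone sets, of the translation orbit $\{\Lambda-x \mid x\in\mathbb{R}^d\}$. Density: let $\mu$ be Lebesgue measure on $\mathbb{R}^d$, and for $A\subset\mathbb{R}^d$ and $\varepsilon>0$ let $A^{+\varepsilon}$ be the set of all $x\in\mathbb{R}^d$ whose Euclidean distance to the topological boundary $\partial A$ is at most $\varepsilon$. A van Hove sequence is a sequence $(A_i)_i$ of compact subsets of $\mathbb{R}^d$ such that $\lim_{i\to\infty}\mu(A_i^{+\varepsilon})/\mu(A_i)=0$ for all $\varepsilon>0$. The density of $\Lambda$ exists if for all van Hove sequences $(A_i)_i$ the limits $\lim_{i\to\infty}\#(A_i\cap\Lambda)/\mu(A_i)$ exist and are identical; the common value is $\mathrm{dens}(\Lambda)$. *)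

theory Defs
  imports "HOL-Analysis.Analysis"
begin

definition translate :: "'a::ab_group_add set \<Rightarrow> 'a \<Rightarrow> 'a set" where
  "translate S x = (\<lambda>y. y - x) ` S"

definition delone :: "'a::euclidean_space set \<Rightarrow> bool" where
  "delone L \<longleftrightarrow>
     (\<exists>r>0. \<forall>c. \<forall>x\<in>L \<inter> ball c r. \<forall>y\<in>L \<inter> ball c r. x = y) \<and>
     (\<exists>R>0. \<forall>c. L \<inter> cball c R \<noteq> {})"

definition bde :: "'a::euclidean_space set \<Rightarrow> 'a set \<Rightarrow> bool" where
  "bde L L' \<longleftrightarrow> (\<exists>\<phi>. bij_betw \<phi> L L' \<and> (\<exists>C. \<forall>x\<in>L. norm (x - \<phi> x) \<le> C))"

definition translation_class :: "'a::ab_group_add set \<Rightarrow> 'a set set" where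
  "translation_class P = range (translate P)"

definition finite_local_complexity :: "'a::euclidean_space set \<Rightarrow> bool" where
  "finite_local_complexity L \<longleftrightarrow>
     (\<forall>K. compact K \<longrightarrow> finite (range (\<lambda>x. translation_class (translate L x \<inter> K))))"

definition repetitive :: "'a::euclidean_space set \<Rightarrow> bool" where
  "repetitive L \<longleftrightarrow>
     (\<forall>K. compact K \<and> K \<inter> L \<noteq> {} \<longrightarrow> delone {x. translate L x \<inter> K = L \<inter> K})"

definition agree_upto :: "real \<Rightarrow> 'a::euclidean_space set \<Rightarrow> 'a set \<Rightarrow> bool" where
  "agree_upto \<epsilon> L L' \<longleftrightarrow>
     (\<exists>x x'. norm x \<le> \<epsilon> / 2 \<and> norm x' \<le> \<epsilon> / 2 \<and>
        translate L x \<inter> cball 0 (1 / \<epsilon>) = translate L' x' \<inter> cball 0 (1 / \<epsilon>))"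

definition local_dist :: "'a::euclidean_space set \<Rightarrow> 'a set \<Rightarrow> real" where
  "local_dist L L' =
     (let E = {\<epsilon>. 0 < \<epsilon> \<and> \<epsilon> < 1 \<and> agree_upto \<epsilon> L L'} in if E = {} then 1 else Inf E)"

lemma mem_translate: "z \<in> translate S x \<longleftrightarrow> z + x \<in> S"
  by (force simp: translate_def algebra_simps)

lemma agree_upto_sym: "agree_upto \<epsilon> L L' \<Longrightarrow> agree_upto \<epsilon> L' L"
  unfolding agree_upto_def by metis

lemma agree_upto_mono:
  assumes "agree_upto \<epsilon> L L'" "0 < \<epsilon>" "\<epsilon> \<le> \<epsilon>'"
  shows "agree_upto \<epsilon>' L L'"
proof -
  obtain x x' where x: "norm x \<le> \<epsilon> / 2" "norm x' \<le> \<epsilon> / 2"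
    and eq: "translate L x \<inter> cball 0 (1 / \<epsilon>) = translate L' x' \<inter> cball 0 (1 / \<epsilon>)"
    using assms(1) unfolding agree_upto_def by blast
  have "(cball 0 (1 / \<epsilon>') :: 'a set) \<subseteq> cball 0 (1 / \<epsilon>)"
    using assms by (intro subset_cball) (simp add: frac_le)
  then have "translate L x \<inter> cball 0 (1 / \<epsilon>') = translate L' x' \<inter> cball 0 (1 / \<epsilon>')"
    using eq by blast
  moreover have "norm x \<le> \<epsilon>' / 2" "norm x' \<le> \<epsilon>' / 2"
    using x assms(3) by linarith+
  ultimately show ?thesis unfolding agree_upto_def by blast
qed

lemma local_dist_eq_Inf:
  assumes "{\<epsilon>. 0 < \<epsilon> \<and> \<epsilon> < 1 \<and> agree_upto \<epsilon> L L'} \<noteq> {}"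
  shows "local_dist L L' = Inf {\<epsilon>. 0 < \<epsilon> \<and> \<epsilon> < 1 \<and> agree_upto \<epsilon> L L'}"
  using assms unfolding local_dist_def Let_def by (rule if_not_P)

lemma local_dist_le_one: "local_dist L L' \<le> 1"
proof -
  let ?E = "{\<epsilon>. 0 < \<epsilon> \<and> \<epsilon> < 1 \<and> agree_upto \<epsilon> L L'}"
  have "bdd_below ?E" by (rule bdd_belowI[of _ 0]) auto
  then have "Inf ?E \<le> e" if "e \<in> ?E" for e using that by (rule cInf_lower[rotated])
  then show ?thesis unfolding local_dist_def Let_def by force
qed

lemma local_dist_le:
  assumes "agree_upto \<epsilon> L L'" "0 < \<epsilon>"
  shows "local_dist L L' \<le> \<epsilon>"
proof (cases "\<epsilon> < 1")
  case True
  let ?E = "{\<epsilon>. 0 < \<epsilon> \<and> \<epsilon> < 1 \<and> agree_upto \<epsilon> L L'}"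
  have "bdd_below ?E" by (rule bdd_belowI[of _ 0]) auto
  moreover have "\<epsilon> \<in> ?E" using True assms by simp
  ultimately have le: "Inf ?E \<le> \<epsilon>" and ne: "?E \<noteq> {}"
    by (auto intro: cInf_lower simp del: mem_Collect_eq)
  show ?thesis unfolding local_dist_eq_Inf[OF ne] by (rule le)
next
  case False
  then show ?thesis using local_dist_le_one[of L L'] by linarith
qed

lemma local_dist_lessD:
  assumes "local_dist L L' < \<epsilon>" "\<epsilon> \<le> 1"
  shows "agree_upto \<epsilon> L L'"
proof -
  let ?E = "{\<epsilon>. 0 < \<epsilon> \<and> \<epsilon> < 1 \<and> agree_upto \<epsilon> L L'}"
  have ne: "?E \<noteq> {}" using assms unfolding local_dist_def Let_def by (auto split: if_splits)
  have "Inf ?E < \<epsilon>" using assms(1) unfolding local_dist_eq_Inf[OF ne] by this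
  then obtain e where "e \<in> ?E" "e < \<epsilon>" using cInf_lessD[OF ne] by blast
  then show ?thesis using agree_upto_mono[of e L L' \<epsilon>] by simp
qed

lemma local_dist_nonneg: "0 \<le> local_dist L L'"
  unfolding local_dist_def Let_def by (auto intro: cInf_greatest)

lemma local_dist_commute: "local_dist L L' = local_dist L' L"
proof -
  have "agree_upto \<epsilon> L L' = agree_upto \<epsilon> L' L" for \<epsilon>
    using agree_upto_sym by blast
  then show ?thesis by (simp add: local_dist_def)
qed

lemma local_dist_refl: "local_dist L L = 0"
proof -
  have "local_dist L L \<le> 0 + \<epsilon>" if "0 < \<epsilon>" for \<epsilon>
  proof -
    have "agree_upto \<epsilon> L L"
      unfolding agree_upto_def using that by (intro exI[of _ 0]) simp
    then show ?thesis using that by (simp add: local_dist_le)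
  qed
  then have "local_dist L L \<le> 0" by (rule field_le_epsilon)
  then show ?thesis using local_dist_nonneg[of L L] by linarith
qed

lemma local_dist_triangle: "local_dist A C \<le> local_dist A B + local_dist B C"
proof (rule field_le_epsilon)
  fix e :: real assume e: "0 < e"
  define a where "a = local_dist A B + e / 2"
  define b where "b = local_dist B C + e / 2"
  have pos: "0 < a" "0 < b"
    using e local_dist_nonneg[of A B] local_dist_nonneg[of B C] by (auto simp: a_def b_def)
  have "local_dist A C \<le> a + b"
  proof (cases "a + b < 1")
    case True
    have "agree_upto a A B" "agree_upto b B C"
      by (rule local_dist_lessD; use e True pos in \<open>simp add: a_def b_def\<close>)+
    then obtain x x' y y' where
      n: "norm x \<le> a / 2" "norm x' \<le> a / 2" "norm y \<le> b / 2" "norm y' \<le> b / 2"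
      and AB: "translate A x \<inter> cball 0 (1 / a) = translate B x' \<inter> cball 0 (1 / a)"
      and BC: "translate B y \<inter> cball 0 (1 / b) = translate C y' \<inter> cball 0 (1 / b)"
      unfolding agree_upto_def by metis
    have rad: "1 / (s + t) + t / 2 \<le> 1 / s" if "0 < s" "0 < t" "s + t < 1" for s t :: real
    proof -
      have "s * (s + t) \<le> 1 * 1" using that by (intro mult_mono) auto
      then have "t * (s * (s + t)) \<le> t * 2" using that by (intro mult_left_mono) auto
      then show ?thesis using that by (simp add: field_simps)
    qed
    have "z \<in> translate A (x + y) \<longleftrightarrow> z \<in> translate C (x' + y')" if z: "z \<in> cball 0 (1 / (a + b))" for z
    proof -
      have "norm (z + y) \<le> 1 / a"
        using z n(3) rad[OF pos True] norm_triangle_ineq[of z y] by simp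
      moreover have "norm (z + x') \<le> 1 / b"
        using z n(2) rad[of b a] pos True norm_triangle_ineq[of z x'] by (simp add: add.commute)
      ultimately have "z + y \<in> translate A x \<longleftrightarrow> z + y \<in> translate B x'"
        "z + x' \<in> translate B y \<longleftrightarrow> z + x' \<in> translate C y'"
        using AB BC by (auto simp: set_eq_iff)
      then show ?thesis by (simp add: mem_translate ac_simps)
    qed
    then have "translate A (x + y) \<inter> cball 0 (1 / (a + b)) = translate C (x' + y') \<inter> cball 0 (1 / (a + b))"
      by blast
    moreover have "norm (x + y) \<le> (a + b) / 2" "norm (x' + y') \<le> (a + b) / 2"
      using n norm_triangle_ineq[of x y] norm_triangle_ineq[of x' y'] by argo+
    ultimately have "agree_upto (a + b) A C" unfolding agree_upto_def by blast
    then show ?thesis using pos by (intro local_dist_le) auto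
  next
    case False
    then show ?thesis using local_dist_le_one[of A C] by linarith
  qed
  then show "local_dist A C \<le> local_dist A B + local_dist B C + e" by (simp add: a_def b_def)
qed

lemma delone_closed:
  assumes "delone L" shows "closed L"
proof -
  obtain r where r: "r > 0" "\<And>c x y. x \<in> L \<inter> ball c r \<Longrightarrow> y \<in> L \<inter> ball c r \<Longrightarrow> x = y"
    using assms unfolding delone_def by blast
  show ?thesis
  proof (rule discrete_imp_closed[OF r(1)], intro ballI impI)
    fix x y assume "x \<in> L" "y \<in> L" "dist y x < r"
    then show "y = x" using r(1) r(2)[of x x y] by (simp add: dist_commute)
  qed
qed

lemma local_dist_zero_subset:
  assumes "local_dist A B = 0" "closed B" shows "A \<subseteq> B"
proof
  fix p assume p: "p \<in> A"
  have "\<exists>q\<in>B. dist q p < e" if e: "0 < e" for e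
  proof -
    define \<epsilon> where "\<epsilon> = min (e / 2) (min (1 / 2) (1 / (norm p + 1)))"
    have np: "0 < norm p + 1" using norm_ge_zero[of p] by linarith
    have \<epsilon>: "0 < \<epsilon>" "\<epsilon> < e" "\<epsilon> < 1" "\<epsilon> \<le> 1 / (norm p + 1)"
      using e np by (auto simp: \<epsilon>_def)
    then have "agree_upto \<epsilon> A B" using assms local_dist_lessD[of A B \<epsilon>] by simp
    then obtain x x' where n: "norm x \<le> \<epsilon> / 2" "norm x' \<le> \<epsilon> / 2"
      and eq: "translate A x \<inter> cball 0 (1 / \<epsilon>) = translate B x' \<inter> cball 0 (1 / \<epsilon>)"
      unfolding agree_upto_def by blast
    have "norm p + 1 \<le> 1 / \<epsilon>" using \<epsilon> np by (simp add: field_simps)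
    then have "norm (p - x) \<le> 1 / \<epsilon>" using n \<epsilon> norm_triangle_ineq4[of p x] by linarith
    moreover have "p - x \<in> translate A x" using p by (simp add: mem_translate)
    ultimately have "p - x \<in> translate B x'" using eq by (auto simp: set_eq_iff)
    then have "p - x + x' \<in> B" by (simp add: mem_translate)
    moreover have "dist (p - x + x') p < e"
      using n \<epsilon> norm_triangle_ineq4[of x' x] by (simp add: dist_norm)
    ultimately show ?thesis by blast
  qed
  then have "p \<in> closure B" by (simp add: closure_approachable)
  then show "p \<in> B" using assms(2) by simp
qed

lemma Metric_space_local_dist: "Metric_space {L. delone L} local_dist"
proof
  fix A B C :: "'a set"
  show "0 \<le> local_dist A B" by (rule local_dist_nonneg)
  show "local_dist A B = local_dist B A" by (rule local_dist_commute)
  show "local_dist A C \<le> local_dist A B + local_dist B C" by (rule local_dist_triangle)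
  assume "A \<in> {L. delone L}" "B \<in> {L. delone L}"
  then have "A = B" if "local_dist A B = 0"
    using that local_dist_zero_subset[of A B] local_dist_zero_subset[of B A]
      local_dist_commute[of A B] delone_closed by auto
  then show "local_dist A B = 0 \<longleftrightarrow> A = B" using local_dist_refl by auto
qed

definition translation_hull :: "'a::euclidean_space set \<Rightarrow> 'a set set" where
  "translation_hull L =
     (Metric_space.mtopology {L. delone L} local_dist) closure_of (range (translate L))"

lemma bde_refl: "bde L L"
  unfolding bde_def by (intro exI[of _ id]) (auto intro: exI[of _ 0])

lemma bde_sym:
  assumes "bde L L'" shows "bde L' L"
proof -
  obtain \<phi> C where \<phi>: "bij_betw \<phi> L L'" and C: "\<And>x. x \<in> L \<Longrightarrow> norm (x - \<phi> x) \<le> C"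
    using assms unfolding bde_def by blast
  have "norm (y - inv_into L \<phi> y) \<le> C" if "y \<in> L'" for y
    using C[of "inv_into L \<phi> y"] that bij_betw_imp_surj_on[OF \<phi>]
    by (simp add: f_inv_into_f inv_into_into norm_minus_commute)
  then show ?thesis using bij_betw_inv_into[OF \<phi>] unfolding bde_def by blast
qed

lemma bde_trans:
  assumes "bde L M" "bde M N" shows "bde L N"
proof -
  obtain \<phi> C where \<phi>: "bij_betw \<phi> L M" and C: "\<And>x. x \<in> L \<Longrightarrow> norm (x - \<phi> x) \<le> C"
    using assms(1) unfolding bde_def by blast
  obtain \<psi> D where \<psi>: "bij_betw \<psi> M N" and D: "\<And>x. x \<in> M \<Longrightarrow> norm (x - \<psi> x) \<le> D"
    using assms(2) unfolding bde_def by blast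
  have "norm (x - (\<psi> \<circ> \<phi>) x) \<le> C + D" if "x \<in> L" for x
    using C[OF that] D[of "\<phi> x"] bij_betwE[OF \<phi>] that
      norm_triangle_ineq[of "x - \<phi> x" "\<phi> x - \<psi> (\<phi> x)"] by simp
  then show ?thesis using bij_betw_trans[OF \<phi> \<psi>] unfolding bde_def by blast
qed

definition bde_classes :: "'a::euclidean_space set set \<Rightarrow> 'a set set set" where
  "bde_classes X = X // {(L, L'). L \<in> X \<and> L' \<in> X \<and> bde L L'}"

lemma equiv_bde: "equiv X {(L, L'). L \<in> X \<and> L' \<in> X \<and> bde L L'}"
  unfolding equiv_def refl_on_def sym_def trans_def
  using bde_refl bde_sym bde_trans by blast

text \<open>The guard is needed because \<^const>\<open>infdist\<close> is \<open>0\<close> for the empty set.\<close>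

definition boundary_nbhd :: "'a::euclidean_space set \<Rightarrow> real \<Rightarrow> 'a set" where
  "boundary_nbhd A \<epsilon> = {x. frontier A \<noteq> {} \<and> infdist x (frontier A) \<le> \<epsilon>}"

text \<open>Positivity of the volumes is implicit in the quotients being defined; it has to be
  required explicitly since division by \<open>0\<close> yields \<open>0\<close>.\<close>

definition van_Hove :: "(nat \<Rightarrow> 'a::euclidean_space set) \<Rightarrow> bool" where
  "van_Hove A \<longleftrightarrow>
     (\<forall>i. compact (A i) \<and> measure lebesgue (A i) > 0) \<and>
     (\<forall>\<epsilon>>0. (\<lambda>i. measure lebesgue (boundary_nbhd (A i) \<epsilon>) / measure lebesgue (A i)) \<longlonglongrightarrow> 0)"

definition density_exists :: "'a::euclidean_space set \<Rightarrow> bool" where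
  "density_exists L \<longleftrightarrow>
     (\<exists>D. \<forall>A. van_Hove A \<longrightarrow>
        (\<lambda>i. real (card (A i \<inter> L)) / measure lebesgue (A i)) \<longlonglongrightarrow> D)"

end

theory Submission
  imports Defs "HOL-Complex_Analysis.Great_Picard"
begin

text \<open>
  The idea is a Baire category argument on the hull \<open>X\<close>. Bounded distance equivalence is the
  countable union over \<open>n\<close> of the relations ``there is a bijection moving no point by more
  than \<open>n\<close>''. By compactness each of these relations is closed (\<open>bde_within_closed\<close>), so every
  equivalence class is a countable union of closed sets. If there are only countably many
  classes, then by Baire some class contains a nonempty open set. Repetitivity makes
  every translation orbit dense in \<open>X\<close> (\<open>repetitive_imp_minimal\<close>), so every orbit enters that
  open set; as a set is equivalent to each of its translates, the class is all of \<open>X\<close>.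

  The argument is carried out with patches \<open>M \<inter> cball 0 \<rho>\<close>. A Delone set belongs to the hull of
  \<open>L\<close> iff each of its central patches occurs somewhere in \<open>L\<close> (\<open>mem_translation_hull_iff\<close>): the
  small shifts allowed in \<open>local_dist\<close> are absorbed by the choice of the place of occurrence.
  The topology in which \<open>M\<close> and \<open>N\<close> are close when they have the same large
  central patch is finer than that of \<open>local_dist\<close>, but minimality holds for it too, and completeness
  becomes trivial: a nested sequence of patches has a union. Hence, if two
  elements of the hull are inequivalent, one can, given any sequence of pairs of an element
  \<open>Q\<close> and a bound \<open>n\<close>, extend a patch step by step so that the \<open>i\<close>-th step excludes
  the \<open>i\<close>-th pair (\<open>patch_excluding_bde_within\<close>). The limit lies in the class of none of the \<open>Q\<close>,
  and so countably many classes never exhaust the hull.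
\<close>

section \<open>Translates\<close>

lemma translate_0 [simp]: "translate S 0 = S"
  by (simp add: translate_def)

lemma delone_translate:
  assumes "delone L" shows "delone (translate L x)"
proof -
  obtain r R where r: "r > 0" "\<And>c y z. y \<in> L \<inter> ball c r \<Longrightarrow> z \<in> L \<inter> ball c r \<Longrightarrow> y = z"
    and R: "R > 0" "\<And>c. L \<inter> cball c R \<noteq> {}"
    using assms unfolding delone_def by blast
  have "y = z" if "y \<in> translate L x \<inter> ball c r" "z \<in> translate L x \<inter> ball c r" for c y z
    using r(2)[of "y + x" "c + x" "z + x"] that by (simp add: mem_translate dist_norm)
  moreover have "translate L x \<inter> cball c R \<noteq> {}" for c
  proof -
    obtain y where "y \<in> L" "dist (c + x) y \<le> R" using R(2)[of "c + x"] by auto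
    then have "y - x \<in> translate L x \<inter> cball c R"
      by (simp add: mem_translate dist_norm algebra_simps)
    then show ?thesis by blast
  qed
  ultimately show ?thesis using r(1) R(1) unfolding delone_def by blast
qed

lemma bde_translate: "bde L (translate L x)"
proof -
  have "bij_betw (\<lambda>y. y - x) L (translate L x)"
    by (simp add: bij_betw_def inj_on_def translate_def)
  moreover have "\<forall>y\<in>L. norm (y - (y - x)) \<le> norm x" by simp
  ultimately show ?thesis unfolding bde_def by blast
qed

section \<open>The hull in terms of patches\<close>

lemma patch_eqD:
  assumes "A \<inter> cball 0 \<rho> = B \<inter> cball 0 \<rho>" "norm z \<le> \<rho>"
  shows "z \<in> A \<longleftrightarrow> z \<in> B"
proof -
  have "z \<in> cball 0 \<rho>" using assms(2) by simp
  then show ?thesis using assms(1) by blast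
qed

text \<open>Both halves of the Delone property concern one bounded region at a time, and a patch
  occurring in \<open>L\<close> inherits them with the radii of \<open>L\<close>.\<close>

lemma delone_if_patches_occur:
  assumes "delone L" and occ: "\<And>\<rho>. \<exists>x. M \<inter> cball 0 \<rho> = translate L x \<inter> cball 0 \<rho>"
  shows "delone M"
proof -
  obtain r R where r: "r > 0" "\<And>c y z. y \<in> L \<inter> ball c r \<Longrightarrow> z \<in> L \<inter> ball c r \<Longrightarrow> y = z"
    and R: "R > 0" "\<And>c. L \<inter> cball c R \<noteq> {}"
    using assms unfolding delone_def by blast
  have "y = z" if yz: "y \<in> M \<inter> ball c r" "z \<in> M \<inter> ball c r" for c y z
  proof -
    obtain x where x: "M \<inter> cball 0 (max (norm y) (norm z)) = translate L x \<inter> cball 0 (max (norm y) (norm z))"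
      using occ by blast
    have "y \<in> translate L x" "z \<in> translate L x"
      using patch_eqD[OF x, of y] patch_eqD[OF x, of z] yz by simp_all
    then show ?thesis
      using r(2)[of "y + x" "c + x" "z + x"] yz by (simp add: mem_translate dist_norm)
  qed
  moreover have "M \<inter> cball c R \<noteq> {}" for c
  proof -
    obtain x where x: "M \<inter> cball 0 (norm c + R) = translate L x \<inter> cball 0 (norm c + R)"
      using occ by blast
    obtain y where y: "y \<in> L" "dist (c + x) y \<le> R" using R(2)[of "c + x"] by auto
    then have *: "y - x \<in> translate L x" "dist c (y - x) \<le> R"
      by (simp_all add: mem_translate dist_norm algebra_simps)
    then have "norm (y - x) \<le> norm c + R"
      using norm_triangle_ineq3[of c "y - x"] by (simp add: dist_norm)
    then have "y - x \<in> M" using patch_eqD[OF x] *(1) by blast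
    then show ?thesis using *(2) by auto
  qed
  ultimately show ?thesis using r(1) R(1) unfolding delone_def by blast
qed

text \<open>If \<open>M - u\<close> and \<open>L - x - v\<close> agree near the origin, then \<open>M\<close> and \<open>L - (v - u + x)\<close> agree on a
  slightly smaller ball: approximate agreement with the orbit of \<open>L\<close> is exact agreement
  with it.\<close>

lemma mem_translation_hull_iff:
  assumes "delone L"
  shows "M \<in> translation_hull L \<longleftrightarrow> (\<forall>\<rho>. \<exists>x. M \<inter> cball 0 \<rho> = translate L x \<inter> cball 0 \<rho>)"
    (is "_ \<longleftrightarrow> ?P")
proof -
  interpret Metric_space "{L. delone L}" local_dist by (rule Metric_space_local_dist)
  have hull: "M \<in> translation_hull L \<longleftrightarrow> delone M \<and> (\<forall>e>0. \<exists>x. local_dist M (translate L x) < e)"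
    unfolding translation_hull_def metric_closure_of
    using delone_translate[OF assms] by auto
  show ?thesis
  proof
    assume M: "M \<in> translation_hull L"
    show ?P
    proof
      fix \<rho> :: real
      \<comment> \<open>Shifting by at most \<open>e / 2 \<le> 1\<close> keeps the ball of radius \<open>\<rho>\<close> inside that of radius \<open>1 / e\<close>.\<close>
      define e where "e = 1 / (\<bar>\<rho>\<bar> + 2)"
      have e: "0 < e" "e \<le> 1" "1 / e = \<bar>\<rho>\<bar> + 2" by (auto simp: e_def field_simps)
      obtain x where "local_dist M (translate L x) < e" using M hull e by blast
      then have "agree_upto e M (translate L x)" using local_dist_lessD e(2) by blast
      then obtain u v where uv: "norm u \<le> e / 2"
        and eq: "translate M u \<inter> cball 0 (1 / e) = translate (translate L x) v \<inter> cball 0 (1 / e)"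
        unfolding agree_upto_def by blast
      have "z \<in> M \<longleftrightarrow> z \<in> translate L (v - u + x)" if "z \<in> cball 0 \<rho>" for z
      proof -
        have "norm (z - u) \<le> 1 / e"
          using that uv e norm_triangle_ineq4[of z u] by simp
        then have "z - u \<in> translate M u \<longleftrightarrow> z - u \<in> translate (translate L x) v"
          by (rule patch_eqD[OF eq])
        then show ?thesis by (simp add: mem_translate algebra_simps)
      qed
      then show "\<exists>x. M \<inter> cball 0 \<rho> = translate L x \<inter> cball 0 \<rho>" by blast
    qed
  next
    assume P: ?P
    have "\<exists>x. local_dist M (translate L x) < e" if "0 < e" for e
    proof -
      obtain x where "M \<inter> cball 0 (1 / (e / 2)) = translate L x \<inter> cball 0 (1 / (e / 2))"
        using P by blast
      then have "agree_upto (e / 2) M (translate L x)"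
        unfolding agree_upto_def using that by (intro exI[of _ 0]) simp
      then have "local_dist M (translate L x) \<le> e / 2"
        using that by (intro local_dist_le) auto
      then show ?thesis using that by (intro exI[of _ x]) auto
    qed
    then show "M \<in> translation_hull L" using hull delone_if_patches_occur[OF assms] P by blast
  qed
qed

lemma translate_mem_translation_hull:
  assumes "delone L" "M \<in> translation_hull L"
  shows "translate M y \<in> translation_hull L"
  unfolding mem_translation_hull_iff[OF assms(1)]
proof
  fix \<rho> :: real
  obtain x where x: "M \<inter> cball 0 (\<rho> + norm y) = translate L x \<inter> cball 0 (\<rho> + norm y)"
    using assms unfolding mem_translation_hull_iff[OF assms(1)] by blast
  have "z \<in> translate M y \<longleftrightarrow> z \<in> translate L (y + x)" if "z \<in> cball 0 \<rho>" for z
  proof -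
    have "norm (z + y) \<le> \<rho> + norm y" using that norm_triangle_ineq[of z y] by simp
    then have "z + y \<in> M \<longleftrightarrow> z + y \<in> translate L x" by (rule patch_eqD[OF x])
    then show ?thesis by (simp add: mem_translate algebra_simps)
  qed
  then show "\<exists>x. translate M y \<inter> cball 0 \<rho> = translate L x \<inter> cball 0 \<rho>" by blast
qed

text \<open>The patch of \<open>M\<close> occurs in \<open>L\<close>, and by repetitivity it does so within a fixed distance
  \<open>R\<close> of every point. So it occurs in every patch of \<open>L\<close> whose radius is large compared
  with \<open>R\<close>, and \<open>N\<close> has such a patch.\<close>

lemma repetitive_imp_minimal:
  assumes L: "delone L" "repetitive L"
    and M: "M \<in> translation_hull L" and N: "N \<in> translation_hull L"
  shows "\<exists>y. translate N y \<inter> cball 0 \<rho> = M \<inter> cball 0 \<rho>"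
proof -
  obtain x where x: "M \<inter> cball 0 \<rho> = translate L x \<inter> cball 0 \<rho>"
    using M mem_translation_hull_iff[OF L(1)] by blast
  obtain R0 where R0: "L \<inter> cball 0 R0 \<noteq> {}"
    using L(1) unfolding delone_def by blast
  \<comment> \<open>\<open>R0\<close> makes \<open>K\<close> meet \<open>L\<close>, as repetitivity requires; the other radius makes \<open>K\<close> contain the
    occurrence of the patch around \<open>x\<close>.\<close>
  define K :: "'a set" where "K = cball 0 (max R0 (\<rho> + norm x))"
  have "cball 0 R0 \<subseteq> K" unfolding K_def by (intro subset_cball) simp
  then have "K \<inter> L \<noteq> {}" using R0 by blast
  then have "delone {p. translate L p \<inter> K = L \<inter> K}"
    using L(2)[unfolded repetitive_def, rule_format, of K] by (simp add: K_def)
  then obtain R where R: "\<And>c. {p. translate L p \<inter> K = L \<inter> K} \<inter> cball c R \<noteq> {}"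
    unfolding delone_def by blast
  obtain z where z: "N \<inter> cball 0 (\<rho> + R + norm x) = translate L z \<inter> cball 0 (\<rho> + R + norm x)"
    using N mem_translation_hull_iff[OF L(1)] by blast
  obtain p where p: "translate L p \<inter> K = L \<inter> K" "dist z p \<le> R"
    using R[of z] by auto
  have "w \<in> translate N (p - z + x) \<longleftrightarrow> w \<in> M" if w: "w \<in> cball 0 \<rho>" for w
  proof -
    have "norm (w + (p - z + x)) \<le> norm w + (norm (p - z) + norm x)"
      by (meson add_left_mono norm_triangle_ineq order_trans)
    then have "norm (w + (p - z + x)) \<le> \<rho> + R + norm x"
      using w p(2) by (simp add: dist_norm norm_minus_commute)
    then have "w \<in> translate N (p - z + x) \<longleftrightarrow> w + (p - z + x) \<in> translate L z"
      using patch_eqD[OF z] by (simp add: mem_translate)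
    also have "\<dots> \<longleftrightarrow> w + x \<in> translate L p" by (simp add: mem_translate algebra_simps)
    also have "\<dots> \<longleftrightarrow> w + x \<in> L"
    proof -
      have "w + x \<in> K" using w norm_triangle_ineq[of w x] by (simp add: K_def)
      then show ?thesis using p(1) by blast
    qed
    also have "\<dots> \<longleftrightarrow> w \<in> M" using patch_eqD[OF x, of w] w by (simp add: mem_translate)
    finally show ?thesis .
  qed
  then show ?thesis by blast
qed

section \<open>Bounded distance equivalence with a fixed bound\<close>

definition bde_within :: "real \<Rightarrow> 'a::euclidean_space set \<Rightarrow> 'a set \<Rightarrow> bool" where
  "bde_within C L M \<longleftrightarrow> (\<exists>\<phi>. bij_betw \<phi> L M \<and> (\<forall>x\<in>L. norm (x - \<phi> x) \<le> C))"

lemma bde_iff_bde_within: "bde L M \<longleftrightarrow> (\<exists>n::nat. bde_within (real n) L M)"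
proof
  assume "bde L M"
  then obtain \<phi> C where \<phi>: "bij_betw \<phi> L M" and C: "\<forall>x\<in>L. norm (x - \<phi> x) \<le> C"
    unfolding bde_def by blast
  obtain n :: nat where "C \<le> real n" using real_arch_simple by blast
  then show "\<exists>n::nat. bde_within (real n) L M"
    using \<phi> C unfolding bde_within_def by (meson order_trans)
qed (auto simp: bde_within_def bde_def)

lemma delone_imp_countable:
  fixes L :: "'a::euclidean_space set"
  assumes "delone L" shows "countable L"
proof -
  obtain r where r: "r > 0" "\<And>c x y. x \<in> L \<inter> ball c r \<Longrightarrow> y \<in> L \<inter> ball c r \<Longrightarrow> x = y"
    using assms unfolding delone_def by blast
  have "L sparse_in UNIV"
    unfolding sparse_in_open[OF open_UNIV]
  proof
    fix c :: 'a
    obtain p where "L \<inter> ball c r \<subseteq> {p}" using r(2)[of _ c] by blast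
    then have "finite (L \<inter> ball c r)" by (rule finite_subset) simp
    then show "\<not> c islimpt L" using r(1) by (auto simp: islimpt_eq_infinite_ball)
  qed
  then show ?thesis using sparse_imp_countable[of UNIV L] by auto
qed

text \<open>A Delone set is discrete, so convergence of points in it means being eventually constant. This turns
  pointwise limits of bijections into exact statements about the bijections themselves.\<close>

lemma delone_limit_eventually_eq:
  assumes "delone L" "u \<longlonglongrightarrow> l" "\<forall>\<^sub>F n in sequentially. u n \<in> L"
  shows "l \<in> L" "\<forall>\<^sub>F n in sequentially. u n = l"
proof -
  obtain r where r: "r > 0" "\<And>c x y. x \<in> L \<inter> ball c r \<Longrightarrow> y \<in> L \<inter> ball c r \<Longrightarrow> x = y"
    using assms(1) unfolding delone_def by blast
  show l: "l \<in> L"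
    using Lim_in_closed_set[OF delone_closed[OF assms(1)] assms(3) _ assms(2)] by simp
  have "\<forall>\<^sub>F n in sequentially. dist (u n) l < r" using assms(2) r(1) by (rule tendstoD)
  then show "\<forall>\<^sub>F n in sequentially. u n = l"
    using assms(3)
  proof eventually_elim
    case (elim n)
    then show ?case using r(1) l r(2)[of "u n" l l] by (simp add: dist_commute)
  qed
qed

text \<open>This is the compactness step. Bijections from \<open>L\<close> to sets that approach \<open>M\<close> move points
  by at most \<open>C\<close>, so a diagonal subsequence makes them and their inverses converge at every
  point of \<open>L\<close> and of \<open>M\<close>. By discreteness the values are eventually constant, and so the two limit maps
  are still inverse to each other. Treating the inverses alongside makes
  injectivity and surjectivity of the limit immediate.\<close>

lemma bde_within_closed:
  assumes L: "delone L" and M: "delone M"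
    and approx: "\<And>\<rho>. \<exists>N. N \<inter> cball 0 \<rho> = M \<inter> cball 0 \<rho> \<and> bde_within C L N"
  shows "bde_within C L M"
proof -
  have "\<exists>\<phi> N. N \<inter> cball 0 (real n) = M \<inter> cball 0 (real n) \<and> bij_betw \<phi> L N
      \<and> (\<forall>x\<in>L. norm (x - \<phi> x) \<le> C)" for n :: nat
    using approx[of "real n"] unfolding bde_within_def by blast
  then obtain \<phi> N where N: "\<And>n. N n \<inter> cball 0 (real n) = M \<inter> cball 0 (real n)"
    and \<phi>: "\<And>n. bij_betw (\<phi> n) L (N n)" and C: "\<And>n x. x \<in> L \<Longrightarrow> norm (x - \<phi> n x) \<le> C"
    by metis
  define \<psi> where "\<psi> n = inv_into L (\<phi> n)" for n
  have \<psi>: "\<psi> n y \<in> L" "\<phi> n (\<psi> n y) = y" if "y \<in> N n" for n y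
    using that bij_betw_imp_surj_on[OF \<phi>[of n]]
    by (auto simp: \<psi>_def inv_into_into f_inv_into_f)
  have \<psi>\<phi>: "\<psi> n (\<phi> n x) = x" if "x \<in> L" for n x
    using that \<phi>[of n] by (simp add: \<psi>_def bij_betw_inv_into_left)
  \<comment> \<open>The displacements of the maps and of their inverses, as one bounded family indexed by
    the disjoint sum of \<open>L\<close> and \<open>M\<close>, so that one subsequence serves both. A point \<open>y\<close>
    of \<open>M\<close> may fail to lie in \<open>N n\<close> for small \<open>n\<close>, where its inverse image is meaningless and
    possibly far away; \<open>0\<close> keeps the family bounded.\<close>
  define f where "f n = case_sum (\<lambda>x. \<phi> n x - x) (\<lambda>y. if y \<in> N n then \<psi> n y - y else 0)" for n
  define S where "S = Inl ` L \<union> Inr ` M"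
  have "countable S"
    using delone_imp_countable[OF L] delone_imp_countable[OF M] by (simp add: S_def)
  moreover have "norm (f n s) \<le> max C 0" if "s \<in> S" for n s
  proof -
    have "norm (\<psi> n y - y) \<le> C" if "y \<in> N n" for y
      using C[of "\<psi> n y" n] \<psi>[OF that] by simp
    then show ?thesis
      using that C by (auto simp: S_def f_def norm_minus_commute le_max_iff_disj)
  qed
  ultimately obtain k where k: "strict_mono k" and lim: "\<And>s. s \<in> S \<Longrightarrow> \<exists>l. (\<lambda>n. f (k n) s) \<longlonglongrightarrow> l"
    using function_convergent_subsequence[of S f "max C 0"] by blast
  have large: "\<forall>\<^sub>F n in sequentially. c \<le> real (k n)" for c
    using filterlim_compose[OF filterlim_real_sequentially filterlim_subseq[OF k]]
    by (simp add: filterlim_at_top)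
  have "\<exists>y\<in>M. \<forall>\<^sub>F n in sequentially. \<phi> (k n) x = y" if x: "x \<in> L" for x
  proof -
    obtain l where "(\<lambda>n. \<phi> (k n) x - x) \<longlonglongrightarrow> l"
      using lim[of "Inl x"] x by (auto simp: S_def f_def)
    from tendsto_add[OF this tendsto_const[of x]] have "(\<lambda>n. \<phi> (k n) x) \<longlonglongrightarrow> l + x" by simp
    moreover have "\<forall>\<^sub>F n in sequentially. \<phi> (k n) x \<in> M"
      using large[of "norm x + C"]
    proof eventually_elim
      case (elim n)
      have "norm (\<phi> (k n) x) \<le> real (k n)"
        using elim C[OF x, of "k n"] norm_triangle_ineq3[of x "\<phi> (k n) x"] by linarith
      moreover have "\<phi> (k n) x \<in> N (k n)" using \<phi> x by (meson bij_betwE)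
      ultimately show ?case using patch_eqD[OF N] by blast
    qed
    ultimately show ?thesis using delone_limit_eventually_eq[OF M] by blast
  qed
  then obtain \<Phi> where \<Phi>: "\<And>x. x \<in> L \<Longrightarrow> \<Phi> x \<in> M"
      "\<And>x. x \<in> L \<Longrightarrow> \<forall>\<^sub>F n in sequentially. \<phi> (k n) x = \<Phi> x"
    by metis
  have inN: "\<forall>\<^sub>F n in sequentially. y \<in> N (k n)" if y: "y \<in> M" for y
    using large[of "norm y"]
  proof eventually_elim
    case (elim n)
    then show ?case using y patch_eqD[OF N] by blast
  qed
  have "\<exists>x\<in>L. \<forall>\<^sub>F n in sequentially. \<psi> (k n) y = x" if y: "y \<in> M" for y
  proof -
    obtain l where "(\<lambda>n. if y \<in> N (k n) then \<psi> (k n) y - y else 0) \<longlonglongrightarrow> l"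
      using lim[of "Inr y"] y by (auto simp: S_def f_def)
    from tendsto_add[OF this tendsto_const[of y]]
    have "(\<lambda>n. (if y \<in> N (k n) then \<psi> (k n) y - y else 0) + y) \<longlonglongrightarrow> l + y" .
    then have "(\<lambda>n. \<psi> (k n) y) \<longlonglongrightarrow> l + y"
      by (rule Lim_transform_eventually) (use inN[OF y] in eventually_elim, simp)
    moreover have "\<forall>\<^sub>F n in sequentially. \<psi> (k n) y \<in> L"
      using inN[OF y] by eventually_elim (rule \<psi>)
    ultimately show ?thesis using delone_limit_eventually_eq[OF L] by blast
  qed
  then obtain \<Psi> where \<Psi>: "\<And>y. y \<in> M \<Longrightarrow> \<Psi> y \<in> L"
      "\<And>y. y \<in> M \<Longrightarrow> \<forall>\<^sub>F n in sequentially. \<psi> (k n) y = \<Psi> y"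
    by metis
  have "\<Psi> (\<Phi> x) = x" if x: "x \<in> L" for x
  proof -
    have "\<forall>\<^sub>F n in sequentially. \<Psi> (\<Phi> x) = x"
      using \<Phi>(2)[OF x] \<Psi>(2)[OF \<Phi>(1)[OF x]]
      by eventually_elim (use \<psi>\<phi>[OF x] in metis)
    then show ?thesis by simp
  qed
  moreover have "\<Phi> (\<Psi> y) = y" if y: "y \<in> M" for y
  proof -
    have "\<forall>\<^sub>F n in sequentially. \<Phi> (\<Psi> y) = y"
      using \<Psi>(2)[OF y] \<Phi>(2)[OF \<Psi>(1)[OF y]] inN[OF y]
      by eventually_elim (use \<psi>(2) in metis)
    then show ?thesis by simp
  qed
  ultimately have "bij_betw \<Phi> L M"
    using \<Phi>(1) \<Psi>(1) by (intro bij_betw_byWitness[of _ \<Psi>]) auto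
  moreover have "norm (x - \<Phi> x) \<le> C" if x: "x \<in> L" for x
  proof -
    have "\<forall>\<^sub>F n in sequentially. norm (x - \<Phi> x) \<le> C"
      using \<Phi>(2)[OF x] by eventually_elim (use C[OF x] in metis)
    then show ?thesis by simp
  qed
  ultimately show ?thesis unfolding bde_within_def by blast
qed

section \<open>The category argument\<close>

text \<open>The density step of the category argument. One of \<open>A\<close> and \<open>B\<close> is not equivalent to \<open>Q\<close>. By minimality a
  translate of it, which is still not equivalent to \<open>Q\<close>, continues the patch of \<open>M\<close>. Since
  equivalence with bound \<open>C\<close> is a closed condition, a large enough patch of this translate
  already rules it out.\<close>

lemma patch_excluding_bde_within:
  assumes L: "delone L" "repetitive L"
    and A: "A \<in> translation_hull L" and B: "B \<in> translation_hull L" "\<not> bde A B"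
    and M: "M \<in> translation_hull L" and Q: "delone Q"
  obtains M' \<rho>' where "M' \<in> translation_hull L" "M' \<inter> cball 0 \<rho> = M \<inter> cball 0 \<rho>" "\<rho> + 1 \<le> \<rho>'"
    "\<And>N. N \<inter> cball 0 \<rho>' = M' \<inter> cball 0 \<rho>' \<Longrightarrow> \<not> bde_within C Q N"
proof -
  obtain E where E: "E \<in> translation_hull L" "\<not> bde Q E"
    using A B bde_sym bde_trans by metis
  obtain y where y: "translate E y \<inter> cball 0 \<rho> = M \<inter> cball 0 \<rho>"
    using repetitive_imp_minimal[OF L M E(1)] by blast
  define M' where "M' = translate E y"
  have M': "M' \<in> translation_hull L"
    unfolding M'_def by (rule translate_mem_translation_hull[OF L(1) E(1)])
  then have "delone M'"
    using delone_if_patches_occur[OF L(1)] mem_translation_hull_iff[OF L(1)] by blast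
  moreover have "\<not> bde_within C Q M'"
  proof
    assume "bde_within C Q M'"
    then have "bde Q M'" by (auto simp: bde_within_def bde_def)
    then show False using E(2) bde_translate[of E y] bde_sym bde_trans unfolding M'_def by blast
  qed
  ultimately obtain \<rho>0 where \<rho>0: "\<And>N. N \<inter> cball 0 \<rho>0 = M' \<inter> cball 0 \<rho>0 \<Longrightarrow> \<not> bde_within C Q N"
    using bde_within_closed[OF Q] by metis
  have "\<not> bde_within C Q N" if N: "N \<inter> cball 0 (max \<rho>0 (\<rho> + 1)) = M' \<inter> cball 0 (max \<rho>0 (\<rho> + 1))" for N
  proof (rule \<rho>0)
    have "cball 0 \<rho>0 \<subseteq> (cball 0 (max \<rho>0 (\<rho> + 1)) :: 'a set)" by (intro subset_cball) simp
    then show "N \<inter> cball 0 \<rho>0 = M' \<inter> cball 0 \<rho>0" using N by blast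
  qed
  then show ?thesis using that[OF M', of "max \<rho>0 (\<rho> + 1)"] y unfolding M'_def by auto
qed

lemma limit_of_nested_patches:
  assumes L: "delone L"
    and M: "\<And>n. M n \<in> translation_hull L"
    and step: "\<And>n. M (Suc n) \<inter> cball 0 (\<rho> n) = M n \<inter> cball 0 (\<rho> n)"
    and \<rho>: "\<And>n. \<rho> n + 1 \<le> \<rho> (Suc n)"
  obtains N where "N \<in> translation_hull L" "\<And>n. N \<inter> cball 0 (\<rho> n) = M n \<inter> cball 0 (\<rho> n)"
proof -
  have mono: "\<rho> m \<le> \<rho> n" if "m \<le> n" for m n
    using \<rho> by (intro lift_Suc_mono_le[OF _ that]) (smt (verit))
  have agree: "M n \<inter> cball 0 (\<rho> m) = M m \<inter> cball 0 (\<rho> m)" if "m \<le> n" for m n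
    using that
  proof (induction rule: dec_induct)
    case (step n)
    have "cball 0 (\<rho> m) \<subseteq> (cball 0 (\<rho> n) :: 'a set)" by (intro subset_cball mono step(1))
    then show ?case using step(3) assms(3)[of n] by blast
  qed simp
  define N where "N = (\<Union>n. M n \<inter> cball 0 (\<rho> n))"
  have N: "N \<inter> cball 0 (\<rho> n) = M n \<inter> cball 0 (\<rho> n)" for n
  proof -
    have "z \<in> M n" if "z \<in> M m" "z \<in> cball 0 (\<rho> m)" "z \<in> cball 0 (\<rho> n)" for z m
    proof (cases "m \<le> n")
      case True
      then show ?thesis using patch_eqD[OF agree[OF True]] that by simp
    next
      case False
      then have "n \<le> m" by simp
      then show ?thesis using patch_eqD[OF agree[OF \<open>n \<le> m\<close>]] that by simp
    qed
    then show ?thesis unfolding N_def by blast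
  qed
  have "\<exists>x. N \<inter> cball 0 s = translate L x \<inter> cball 0 s" for s
  proof -
    have lower: "\<rho> 0 + real n \<le> \<rho> n" for n
    proof (induction n)
      case (Suc n)
      then show ?case using \<rho>[of n] by simp
    qed simp
    obtain n :: nat where "s - \<rho> 0 \<le> real n" using real_arch_simple by blast
    then have s: "cball 0 s \<subseteq> (cball 0 (\<rho> n) :: 'a set)" using lower[of n] by (intro subset_cball) simp
    obtain x where "M n \<inter> cball 0 (\<rho> n) = translate L x \<inter> cball 0 (\<rho> n)"
      using M mem_translation_hull_iff[OF L] by blast
    then show ?thesis using N[of n] s by (intro exI[of _ x]) blast
  qed
  then have "N \<in> translation_hull L" using mem_translation_hull_iff[OF L] by blast
  then show ?thesis using N by (rule that)
qed

text \<open>If \<open>A\<close> and \<open>B\<close> were inequivalent, a nested sequence of patches could exclude all pairs of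
  a representative and an integer bound in turn, and its limit would be equivalent to no
  representative.\<close>

lemma countable_bde_representatives_imp_bde:
  assumes L: "delone L" "repetitive L"
    and Q: "\<And>i::nat. Q i \<in> translation_hull L"
    and cover: "\<And>N. N \<in> translation_hull L \<Longrightarrow> \<exists>i. bde (Q i) N"
    and A: "A \<in> translation_hull L" and B: "B \<in> translation_hull L"
  shows "bde A B"
proof (rule ccontr)
  assume nb: "\<not> bde A B"
  have dQ: "delone (Q i)" for i
    using Q delone_if_patches_occur[OF L(1)] mem_translation_hull_iff[OF L(1)] by blast
  \<comment> \<open>A state pairs an element of the hull with the radius of its fixed patch. Step \<open>n\<close> excludes
    the representative and the bound encoded by \<open>n\<close>.\<close>
  define P where "P n s t \<longleftrightarrow> fst t \<inter> cball 0 (snd s) = fst s \<inter> cball 0 (snd s) \<and> snd s + 1 \<le> snd t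
      \<and> (\<forall>N. N \<inter> cball 0 (snd t) = fst t \<inter> cball 0 (snd t)
            \<longrightarrow> \<not> bde_within (real (snd (prod_decode n))) (Q (fst (prod_decode n))) N)"
    for n and s t :: "'a set \<times> real"
  have "\<exists>S. \<forall>n. fst (S n) \<in> translation_hull L \<and> P n (S n) (S (Suc n))"
  proof (rule dependent_nat_choice)
    show "\<exists>s :: 'a set \<times> real. fst s \<in> translation_hull L" using A by (intro exI[of _ "(A, 0)"]) simp
  next
    fix s :: "'a set \<times> real" and n :: nat
    assume "fst s \<in> translation_hull L"
    from patch_excluding_bde_within[OF L A B nb this dQ]
    obtain M' \<rho>' where "M' \<in> translation_hull L" "P n s (M', \<rho>')"
      unfolding P_def fst_conv snd_conv by metis
    then show "\<exists>t. fst t \<in> translation_hull L \<and> P n s t" by (intro exI[of _ "(M', \<rho>')"]) simp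
  qed
  then obtain S where S: "\<And>n. fst (S n) \<in> translation_hull L" "\<And>n. P n (S n) (S (Suc n))" by blast
  have nested: "fst (S (Suc n)) \<inter> cball 0 (snd (S n)) = fst (S n) \<inter> cball 0 (snd (S n))"
    and growing: "snd (S n) + 1 \<le> snd (S (Suc n))" for n
    using S(2)[of n] unfolding P_def by blast+
  obtain N where N: "N \<in> translation_hull L"
      "\<And>n. N \<inter> cball 0 (snd (S n)) = fst (S n) \<inter> cball 0 (snd (S n))"
    by (rule limit_of_nested_patches[where M = "\<lambda>n. fst (S n)" and \<rho> = "\<lambda>n. snd (S n)",
          OF L(1) S(1) nested growing])
      (rule that)
  obtain i where "bde (Q i) N" using cover N(1) by blast
  then obtain m :: nat where "bde_within (real m) (Q i) N" using bde_iff_bde_within by blast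
  moreover have "\<not> bde_within (real m) (Q i) N"
    using S(2)[of "prod_encode (i, m)"] N(2)[of "Suc (prod_encode (i, m))"]
    unfolding P_def prod_encode_inverse fst_conv snd_conv by blast
  ultimately show False by blast
qed

theorem theorem1p1:
  fixes \<Lambda> :: "'a::euclidean_space set"
  assumes "delone \<Lambda>"
    and "repetitive \<Lambda>"
    and "finite_local_complexity \<Lambda>"
    and "density_exists \<Lambda>"
  shows "(\<exists>C. bde_classes (translation_hull \<Lambda>) = {C}) \<or> uncountable (bde_classes (translation_hull \<Lambda>))"
proof (cases "countable (bde_classes (translation_hull \<Lambda>))")
  case True
  define X where "X = translation_hull \<Lambda>"
  define E where "E = {(L, L'). L \<in> X \<and> L' \<in> X \<and> bde L L'}"
  have E: "equiv X E" unfolding E_def by (rule equiv_bde)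
  have classes: "bde_classes (translation_hull \<Lambda>) = X // E"
    by (simp add: bde_classes_def X_def E_def)
  have mem: "\<Lambda> \<in> X"
    unfolding X_def mem_translation_hull_iff[OF assms(1)] by (metis translate_0)
  then have ne: "X // E \<noteq> {}" by (auto simp: quotient_def)
  obtain c :: "nat \<Rightarrow> _" where c: "range c = X // E"
    using range_from_nat_into[OF ne] True unfolding classes by blast
  have "\<exists>q\<in>X. c i = E `` {q}" for i
  proof -
    have "c i \<in> X // E" using c by blast
    then show ?thesis by (rule quotientE) blast
  qed
  then obtain Q where Q: "\<And>i. Q i \<in> X" "\<And>i. c i = E `` {Q i}" by metis
  have cover: "\<exists>i. bde (Q i) N" if N: "N \<in> X" for N
  proof -
    have "E `` {N} \<in> range c" unfolding c using N by (rule quotientI)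
    then obtain i where "E `` {Q i} = E `` {N}" using Q(2) by auto
    then have "(Q i, N) \<in> E" using eq_equiv_class[OF _ E N] by blast
    then show ?thesis by (auto simp: E_def)
  qed
  have "bde A B" if "A \<in> X" "B \<in> X" for A B
    using countable_bde_representatives_imp_bde[OF assms(1,2)] Q(1) cover that
    unfolding X_def by blast
  then have "E `` {A} = X" if "A \<in> X" for A using that by (auto simp: E_def)
  then have "X // E = {X}" using mem by (auto simp: quotient_def)
  then show ?thesis unfolding classes by blast
qed simp

end
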